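(* (1) If a Legendrian submanifold $L$ of $J^1(\mathbb{R}^n,\mathbb{R})$ is the contour of a generating function $F$ defined on $\mathbb{R}^n\times(\mathbb{R}^k)$, then $\mathbf{T}L$ is the contour of $F_{\mathbf{T}}$ defined on $\mathbb{R}^n\times(\mathbb{R}^n\times\mathbb{R}^k)$ by $F_{\mathbf{T}}(q,v,w)=qv-F(v,w)$. (2) If a Legendrian submanifold $L$ of $J^1(\mathbb{R}^{n_1}\times\mathbb{R}^{n_2},\mathbb{R})$ is the contour of $F$ defined on $\mathbb{R}^{n_1}\times\mathbb{R}^{n_2}\times(\mathbb{R}^k)$, then - the slice $\sigma(L)$ along $\mathbb{R}^{n_1}\times\{0\}$ is the contour of $F_\sigma$ defined on $\mathbb{R}^{n_1}\times(\mathbb{R}^k)$ by $F_\sigma(q_1,w)=F(q_1,0,w)$; - the contour $\kappa(L)$ in the direction of $\mathbb{R}^{n_1}\times\{0\}$ is the contour of $F_\kappa$ defined on $\mathbb{R}^{n_1}\times(\mathbb{R}^{n_2}\times\mathbb{R}^k)$ by $F_\kappa(q_1,v,w)=F(q_1,v,w)$. (3) If $L_1$ and $L_2$ are Legendrian submanifolds of $J^1(\mathbb{R}^{n_1},\mathbb{R})$ and $J^1(\mathbb{R}^{n_2},\mathbb{R})$ respectively, such that $L_1$ is the contour of $F_1$ defined on $\mathbb{R}^{n_1}\times(\mathbb{R}^{k_1})$ and $L_2$ is the contour of $F_2$ defined on $\mathbb{R}^{n_2}\times(\mathbb{R}^{k_2})$, then the product $L_1\underline{\times}L_2$ is the contour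 of $F_{1\underline{\times}2}$ defined on $\mathbb{R}^{n_1}\times\mathbb{R}^{n_2}\times(\mathbb{R}^{k_1}\times\mathbb{R}^{k_2})$ by $F_{1\underline{\times}2}(q_1,q_2,w_1,w_2)=F_1(q_1,w_1)+F_2(q_2,w_2)$. (4) If $L_1$ and $L_2$ are Legendrian submanifolds of $J^1(\mathbb{R}^n,\mathbb{R})$ which are the contours of, respectively, $F_1$ defined on $\mathbb{R}^n\times(\mathbb{R}^{k_1})$ and $F_2$ defined on $\mathbb{R}^n\times(\mathbb{R}^{k_2})$, then - the sum $L_1\underline{+}L_2$ is the contour of $F_{1\underline{+}2}$ defined on $\mathbb{R}^n\times(\mathbb{R}^{k_1}\times\mathbb{R}^{k_2})$ by $F_{1\underline{+}2}(q,w_1,w_2)=F_1(q,w_1)+F_2(q,w_2)$; - the convolution $L_1\underline{\square}L_2$ is the contour of $F_{1\underline{\square}2}$ defined on $\mathbb{R}^n\times(\mathbb{R}^n\times\mathbb{R}^{k_1}\times\mathbb{R}^{k_2})$ by $F_{1\underline{\square}2}(q,v,w_1,w_2)=F_1(v,w_1)+F_2(q-v,w_2)$.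
   Context: All objects are smooth. $J^1(\mathbb{R}^n,\mathbb{R})=\mathbb{R}\times\mathbb{R}^n\times\mathbb{R}^n$ has coordinates $(u,q,p)$ and contact form $du-p\,dq=du-\sum_i p_i\,dq_i$; a Legendrian submanifold is an $n$-dimensional submanifold on which this form vanishes. On $J^1(\mathbb{R}^{n_1}\times\mathbb{R}^{n_2},\mathbb{R})$ the coordinates are $(u,q_1,q_2,p_1,p_2)$. Generating functions: a function $F$ defined on $\mathbb{R}^n\times(\mathbb{R}^k)$ means a smooth function $F(q,w)$ on $\mathbb{R}^n\times\mathbb{R}^k$ where $q\in\mathbb{R}^n$ is the base variable and the bracketed factor carries the additional variables $w$. Its contour is the subset of $J^1(\mathbb{R}^n,\mathbb{R})$ $$L_F=\{(F(q,w),q,\nabla_qF(q,w))\mid q\in\mathbb{R}^n,\ w\in\mathbb{R}^k,\ \nabla_wF(q,w)=0\},$$ and $F$ is then called a generating function for $L_F$; $\nabla_q,\nabla_w$ denote partial gradients. Operations: $\mathbf{T}(u,q,p)=(qp-u,p,q)$ ($qp$ is the Euclidean scalar product), and $\mathbf{T}L$ is the image of $L$. For $L\subset J^1(\mathbb{R}^{n_1}\times\mathbb{R}^{n_2},\mathbb{R})$, the slice is $\sigma(L)=\{(u,q_1,p_1)\mid\exists p_2,\ (u,q_1,0,p_1,p_2)\in L\}$ and the contour is $\kappa(L)=\{(u,q_1,p_1)\mid\exists q_2,\ (u,q_1,q_2,p_1,0)\in L\}$, both subsets of $J^1(\mathbb{R}^{n_1},\mathbb{R})$. The product is $L_1\underline{\times}L_2=\{(u_1+u_2,q_1,q_2,p_1,p_2)\mid(u_i,q_i,p_i)\in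 L_i\}$. The sum is $L_1\underline{+}L_2=\{(u_1+u_2,q,p_1+p_2)\mid(u_i,q,p_i)\in L_i\}$ and the convolution is $L_1\underline{\square}L_2=\{(u_1+u_2,q_1+q_2,p)\mid(u_i,q_i,p)\in L_i\}$. *)

theory Defs
  imports "HOL-Analysis.Analysis"
begin

text \<open>
  A type of the following class stands for some \<open>\<real>\<^sup>n\<close> with its scalar product. The axiom is
  that of \<^class>\<open>euclidean_space\<close> (a finite orthonormal basis), except that the basis may be
  empty: \<open>n = 0\<close> is not excluded, which matters for generating functions without additional
  variables. The type \<^typ>\<open>unit\<close> below is an instance of dimension 0.
\<close>

class finite_dim_inner = real_inner +
  assumes finite_orthonormal_basis:
    "\<exists>B. finite B \<and> (\<forall>u\<in>B. \<forall>v\<in>B. inner u v = (if u = v then 1 else 0)) \<and>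
         (\<forall>x. (\<forall>u\<in>B. inner x u = 0) \<longleftrightarrow> x = 0)"

instance euclidean_space \<subseteq> finite_dim_inner
  by standard
    (intro exI[of _ Basis] conjI ballI allI finite_Basis inner_Basis euclidean_all_zero_iff)

instance prod :: (finite_dim_inner, finite_dim_inner) finite_dim_inner
proof
  obtain B :: "'a set" where B: "finite B" "\<forall>u\<in>B. \<forall>v\<in>B. u \<bullet> v = (if u = v then 1 else 0)"
      "\<forall>x. (\<forall>u\<in>B. x \<bullet> u = 0) \<longleftrightarrow> x = 0"
    using finite_orthonormal_basis by (elim exE conjE)
  obtain C :: "'b set" where C: "finite C" "\<forall>u\<in>C. \<forall>v\<in>C. u \<bullet> v = (if u = v then 1 else 0)"
      "\<forall>x. (\<forall>u\<in>C. x \<bullet> u = 0) \<longleftrightarrow> x = 0"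
    using finite_orthonormal_basis by (elim exE conjE)
  have nz: "0 \<notin> B" "0 \<notin> C"
    using B(2)[rule_format, of 0 0] C(2)[rule_format, of 0 0] by auto
  let ?D = "(\<lambda>x. (x, 0)) ` B \<union> (\<lambda>y. (0, y)) ` C"
  have "finite ?D"
    using B(1) C(1) by simp
  moreover have "\<forall>u\<in>?D. \<forall>v\<in>?D. u \<bullet> v = (if u = v then 1 else 0)"
    using B(2) C(2) nz by (auto simp: ball_Un inner_prod_def)
  moreover have "(\<forall>u\<in>?D. z \<bullet> u = 0) \<longleftrightarrow> z = 0" for z :: "'a \<times> 'b"
  proof -
    have "(\<forall>u\<in>?D. z \<bullet> u = 0) \<longleftrightarrow> (\<forall>u\<in>B. fst z \<bullet> u = 0) \<and> (\<forall>u\<in>C. snd z \<bullet> u = 0)"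
      by (simp add: ball_Un inner_prod_def)
    then show ?thesis
      using B(3) C(3) by (simp add: prod_eq_iff)
  qed
  ultimately show "\<exists>D :: ('a \<times> 'b) set. finite D \<and>
      (\<forall>u\<in>D. \<forall>v\<in>D. u \<bullet> v = (if u = v then 1 else 0)) \<and> (\<forall>z. (\<forall>u\<in>D. z \<bullet> u = 0) \<longleftrightarrow> z = 0)"
    by (intro exI[of _ ?D] conjI allI)
qed

instantiation unit :: real_inner
begin

definition "(0 :: unit) = ()"
definition "(x :: unit) + y = ()"
definition "r *\<^sub>R (x :: unit) = ()"
definition "(x :: unit) \<bullet> y = 0"
definition "norm (x :: unit) = 0"
definition "sgn (x :: unit) = ()"
definition "dist (x :: unit) y = 0"
definition "(uniformity :: (unit \<times> unit) filter) = (INF e\<in>{0<..}. principal {(x, y). dist x y < e})"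
definition "open (U :: unit set) \<longleftrightarrow> (\<forall>x\<in>U. eventually (\<lambda>(x', y). x' = x \<longrightarrow> y \<in> U) uniformity)"

lemma unit_all_equal: "(x :: unit) = y"
  by simp

instance
proof
  show "uniformity = (INF e\<in>{0<..}. principal {(x :: unit, y). dist x y < e})"
    by (rule uniformity_unit_def)
  show "open U \<longleftrightarrow> (\<forall>x\<in>U. eventually (\<lambda>(x', y). x' = x \<longrightarrow> y \<in> U) uniformity)" for U :: "unit set"
    by (rule open_unit_def)
qed (rule unit_all_equal | simp only: inner_unit_def norm_unit_def dist_unit_def | simp)+

end

instance unit :: finite_dim_inner
  by standard (rule exI[of _ "{}"], simp)


text \<open>
  Smoothness on an open set, by iterating directional derivatives. On a finite-dimensional domain,
  \<^term>\<open>Ck_on k S f\<close> says that \<^term>\<open>f\<close> is \<open>k\<close> times continuously differentiable on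
  \<^term>\<open>S\<close>.
\<close>

primrec Ck_on ::
  "nat \<Rightarrow> 'a::real_normed_vector set \<Rightarrow> ('a \<Rightarrow> 'b::real_normed_vector) \<Rightarrow> bool" where
  "Ck_on 0 S f \<longleftrightarrow> continuous_on S f"
| "Ck_on (Suc k) S f \<longleftrightarrow>
     (\<forall>x\<in>S. f differentiable (at x)) \<and> (\<forall>v. Ck_on k S (\<lambda>x. frechet_derivative f (at x) v))"

definition smooth_on :: "'a::real_normed_vector set \<Rightarrow> ('a \<Rightarrow> 'b::real_normed_vector) \<Rightarrow> bool" where
  "smooth_on S f \<longleftrightarrow> (\<forall>k. Ck_on k S f)"

definition gradient :: "('a::real_inner \<Rightarrow> real) \<Rightarrow> 'a \<Rightarrow> 'a" where
  "gradient f x = (THE D. GDERIV f x :> D)"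


text \<open>Embedded submanifolds of dimension \<open>d\<close>, by straightening charts of the ambient space.\<close>

definition submanifold :: "nat \<Rightarrow> 'a::real_normed_vector set \<Rightarrow> bool" where
  "submanifold d M \<longleftrightarrow>
     (\<forall>z\<in>M. \<exists>U V \<phi> \<psi>. \<exists>P :: 'a set.
        open U \<and> z \<in> U \<and> open V \<and> homeomorphism U V \<phi> \<psi> \<and> smooth_on U \<phi> \<and> smooth_on V \<psi> \<and>
        subspace P \<and> dim P = d \<and> \<phi> ` (M \<inter> U) = P \<inter> V)"

definition tangent_vectors :: "'a::real_normed_vector set \<Rightarrow> 'a \<Rightarrow> 'a set" where
  "tangent_vectors M z =
     {v. \<exists>e>0. \<exists>c :: real \<Rightarrow> 'a. smooth_on {-e<..<e} c \<and> c ` {-e<..<e} \<subseteq> M \<and> c 0 = z \<and>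
                         (c has_vector_derivative v) (at 0)}"


text \<open>A point \<open>(u, q, p)\<close> of the 1-jet space \<open>J\<^sup>1(\<real>\<^sup>n, \<real>)\<close>.\<close>

type_synonym 'a jet = "real \<times> 'a \<times> 'a"

definition contact_form :: "'a::real_inner jet \<Rightarrow> 'a jet \<Rightarrow> real" where
  "contact_form = (\<lambda>(u, q, p) (du, dq, dp). du - p \<bullet> dq)"

definition legendrian :: "'a::real_inner jet set \<Rightarrow> bool" where
  "legendrian L \<longleftrightarrow>
     submanifold (dim (UNIV :: 'a set)) L \<and>
     (\<forall>z\<in>L. \<forall>v\<in>tangent_vectors L z. contact_form z v = 0)"


text \<open>In \<open>F (q, w)\<close>, \<open>q\<close> is the base variable and \<open>w\<close> collects the additional variables.\<close>

definition contour :: "('a::real_inner \<times> 'w::real_inner \<Rightarrow> real) \<Rightarrow> 'a jet set" where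
  "contour F =
     {(F (q, w), q, gradient (\<lambda>q'. F (q', w)) q) | q w. gradient (\<lambda>w'. F (q, w')) w = 0}"

text \<open>\<open>L\<close> is the contour of the (smooth) generating function \<open>F\<close>.\<close>

definition is_contour_of ::
  "'a::real_inner jet set \<Rightarrow> ('a \<times> 'w::real_inner \<Rightarrow> real) \<Rightarrow> bool" where
  "is_contour_of L F \<longleftrightarrow> smooth_on UNIV F \<and> L = contour F"


definition jet_transform :: "'a::real_inner jet \<Rightarrow> 'a jet" where
  "jet_transform = (\<lambda>(u, q, p). (q \<bullet> p - u, p, q))"

definition jet_slice :: "('a::real_inner \<times> 'b::real_inner) jet set \<Rightarrow> 'a jet set" where
  "jet_slice L = {(u, q1, p1) | u q1 p1. \<exists>p2. (u, (q1, 0), (p1, p2)) \<in> L}"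

definition jet_contour :: "('a::real_inner \<times> 'b::real_inner) jet set \<Rightarrow> 'a jet set" where
  "jet_contour L = {(u, q1, p1) | u q1 p1. \<exists>q2. (u, (q1, q2), (p1, 0)) \<in> L}"

definition jet_prod ::
  "'a::real_inner jet set \<Rightarrow> 'b::real_inner jet set \<Rightarrow> ('a \<times> 'b) jet set" where
  "jet_prod L1 L2 =
     {(u1 + u2, (q1, q2), (p1, p2)) | u1 u2 q1 q2 p1 p2. (u1, q1, p1) \<in> L1 \<and> (u2, q2, p2) \<in> L2}"

definition jet_sum :: "'a::real_inner jet set \<Rightarrow> 'a jet set \<Rightarrow> 'a jet set" where
  "jet_sum L1 L2 =
     {(u1 + u2, q, p1 + p2) | u1 u2 q p1 p2. (u1, q, p1) \<in> L1 \<and> (u2, q, p2) \<in> L2}"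

definition jet_convolution :: "'a::real_inner jet set \<Rightarrow> 'a jet set \<Rightarrow> 'a jet set" where
  "jet_convolution L1 L2 =
     {(u1 + u2, q1 + q2, p) | u1 u2 q1 q2 p. (u1, q1, p) \<in> L1 \<and> (u2, q2, p) \<in> L2}"

end

theory Submission
  imports Defs
begin

text \<open>
  All the operations act on generating functions by linear substitutions \<open>F \<circ> A\<close>, by sums and signs,
  and by adding the quadratic form \<open>q \<bullet> v\<close>. Smoothness is stable under these, and each of them
  changes the total gradient in an explicit way: a substitution applies the adjoint of \<open>A\<close>
  (\<open>GDERIV_compose_linear\<close>). Since partial gradients are the components of the total one, a
  jet \<open>(u, q, p)\<close> lies on the contour of a smooth \<open>F\<close> iff some \<open>w\<close> satisfies
  \<open>F (q, w) = u\<close> and \<open>\<nabla>F (q, w) = (p, 0)\<close> (\<open>mem_contour_iff\<close>). Every claim of the theorem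
  then amounts to reading this condition for the new function:

  \<^item> for \<open>q \<bullet> v - F (v, w)\<close> the gradient is \<open>(v, q - a, - b)\<close> with \<open>(a, b) = \<nabla>F (v, w)\<close>, so
    criticality in \<open>v\<close> says \<open>q = a\<close> and the new covector is \<open>v\<close>: base and covector are swapped;
  \<^item> freezing \<open>q2 = 0\<close> forgets the covector component \<open>p2\<close> (slice), whereas counting \<open>q2\<close> among
    the additional variables imposes \<open>p2 = 0\<close> (contour);
  \<^item> for a sum of two functions of separate variables the gradients are juxtaposed (product), and
    those with respect to a shared base variable are added (sum);
  \<^item> for \<open>F1 (v, w1) + F2 (q - v, w2)\<close> criticality in \<open>v\<close> says that both covectors agree, which is
    the matching condition of the convolution.
\<close>


section \<open>Smooth functions\<close>

text \<open>
  Only the domain \<^const>\<open>UNIV\<close> is treated: in the inductive steps the formula for the derivative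
  is then an equation between functions, and it can be rewritten below \<^const>\<open>Ck_on\<close>.
\<close>

lemma Ck_on_Suc_UNIV_I:
  assumes "\<And>x. (f has_derivative f' x) (at x)" and "\<And>v. Ck_on k UNIV (\<lambda>x. f' x v)"
  shows "Ck_on (Suc k) UNIV f"
proof -
  have "frechet_derivative f (at x) = f' x" for x
    using frechet_derivative_at[OF assms(1)] by simp
  then show ?thesis
    using assms by (auto simp: differentiable_def)
qed

lemma Ck_on_const: "Ck_on k UNIV (\<lambda>x. c)"
proof (induction k arbitrary: c)
  case (Suc k)
  show ?case
    by (rule Ck_on_Suc_UNIV_I[where f' = "\<lambda>_ _. 0"]) (auto intro: Suc.IH)
qed simp

lemma Ck_on_bounded_linear:
  assumes "bounded_linear A"
  shows "Ck_on k UNIV A"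
proof (cases k)
  case 0
  then show ?thesis
    using assms by (simp add: linear_continuous_on)
next
  case (Suc m)
  show ?thesis
    unfolding Suc
    by (rule Ck_on_Suc_UNIV_I[where f' = "\<lambda>_. A"])
      (auto intro: bounded_linear_imp_has_derivative assms Ck_on_const)
qed

text \<open>The scalar makes sums and differences instances of one induction.\<close>

lemma Ck_on_add_scaleR:
  assumes "Ck_on k UNIV f" "Ck_on k UNIV g"
  shows "Ck_on k UNIV (\<lambda>x. f x + c *\<^sub>R g x)"
  using assms
proof (induction k arbitrary: f g)
  case 0
  then show ?case by (simp add: continuous_on_add continuous_on_scaleR)
next
  case (Suc k)
  show ?case
  proof (rule Ck_on_Suc_UNIV_I)
    show "((\<lambda>x. f x + c *\<^sub>R g x) has_derivative
        (\<lambda>v. frechet_derivative f (at x) v + c *\<^sub>R frechet_derivative g (at x) v)) (at x)" for x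
      using Suc.prems
      by (auto intro!: has_derivative_add has_derivative_scaleR_right
          simp flip: frechet_derivative_works)
  qed (use Suc in auto)
qed

text \<open>The directional derivatives of \<open>f \<circ> A\<close> are again composites of a smooth function with \<open>A\<close>.\<close>

lemma Ck_on_compose_linear:
  assumes "bounded_linear A" "Ck_on k UNIV f"
  shows "Ck_on k UNIV (\<lambda>x. f (A x))"
  using assms(2)
proof (induction k arbitrary: f)
  case 0
  then show ?case
    using continuous_on_compose2[of UNIV f UNIV A] linear_continuous_on[OF assms(1)] by simp
next
  case (Suc k)
  show ?case
  proof (rule Ck_on_Suc_UNIV_I)
    have "(f has_derivative frechet_derivative f (at y)) (at y)" for y
      using Suc.prems by (simp flip: frechet_derivative_works)
    then show "((\<lambda>x. f (A x)) has_derivative (\<lambda>v. frechet_derivative f (at (A x)) (A v))) (at x)" for x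
      by (rule has_derivative_compose[OF bounded_linear_imp_has_derivative[OF assms(1)]])
  qed (use Suc in auto)
qed

text \<open>A derivative in a fixed direction of a product of linear maps is linear in the base point.\<close>

lemma Ck_on_inner_linear:
  assumes "bounded_linear A" "bounded_linear B"
  shows "Ck_on k UNIV (\<lambda>x. A x \<bullet> B x)"
proof (cases k)
  case 0
  then show ?thesis
    using assms by (simp add: continuous_on_inner linear_continuous_on)
next
  case (Suc m)
  have "bounded_linear (\<lambda>x. A x \<bullet> B v + A v \<bullet> B x)" for v
    by (intro bounded_linear_add assms
        bounded_linear_compose[OF bounded_linear_inner_left]
        bounded_linear_compose[OF bounded_linear_inner_right])
  then show ?thesis
    unfolding Suc
    by (intro Ck_on_Suc_UNIV_I[where f' = "\<lambda>x v. A x \<bullet> B v + A v \<bullet> B x"] Ck_on_bounded_linear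
        has_derivative_inner bounded_linear_imp_has_derivative assms)
qed

lemma smooth_on_UNIV_add:
  assumes "smooth_on UNIV f" "smooth_on UNIV g"
  shows "smooth_on UNIV (\<lambda>x. f x + g x)"
  using assms Ck_on_add_scaleR[of _ f g 1] by (simp add: smooth_on_def)

lemma smooth_on_UNIV_diff:
  assumes "smooth_on UNIV f" "smooth_on UNIV g"
  shows "smooth_on UNIV (\<lambda>x. f x - g x)"
  using assms Ck_on_add_scaleR[of _ f g "-1"] by (simp add: smooth_on_def)

lemma smooth_on_UNIV_compose_linear:
  "bounded_linear A \<Longrightarrow> smooth_on UNIV f \<Longrightarrow> smooth_on UNIV (\<lambda>x. f (A x))"
  by (simp add: smooth_on_def Ck_on_compose_linear)

lemma smooth_on_UNIV_inner_linear:
  "bounded_linear A \<Longrightarrow> bounded_linear B \<Longrightarrow> smooth_on UNIV (\<lambda>x. A x \<bullet> B x)"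
  by (simp add: smooth_on_def Ck_on_inner_linear)


section \<open>Gradients\<close>

lemma GDERIV_unique:
  assumes "GDERIV f x :> D" "GDERIV f x :> E"
  shows "D = E"
proof -
  have "(\<lambda>h. h \<bullet> D) = (\<lambda>h. h \<bullet> E)"
    using assms unfolding gderiv_def by (rule has_derivative_unique)
  then have "(D - E) \<bullet> D = (D - E) \<bullet> E" by (rule fun_cong)
  then have "(D - E) \<bullet> (D - E) = 0" by (simp add: inner_diff_right)
  then show ?thesis by simp
qed

lemma gradient_eqI: "GDERIV f x :> D \<Longrightarrow> gradient f x = D"
  unfolding gradient_def by (blast intro: GDERIV_unique)

text \<open>
  In finite dimension a linear functional \<open>f\<close> is represented by \<open>\<Sum>b\<in>B. f b *\<^sub>R b\<close>, for \<open>B\<close> an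
  orthonormal basis.
\<close>

lemma linear_functional_representation:
  fixes f :: "'a::finite_dim_inner \<Rightarrow> real"
  assumes "linear f"
  shows "\<exists>D. \<forall>x. f x = x \<bullet> D"
proof -
  obtain B :: "'a set" where B: "finite B" "\<forall>u\<in>B. \<forall>v\<in>B. u \<bullet> v = (if u = v then 1 else 0)"
      "\<forall>x. (\<forall>u\<in>B. x \<bullet> u = 0) \<longleftrightarrow> x = 0"
    using finite_orthonormal_basis by (elim exE conjE)
  have expansion: "x = (\<Sum>b\<in>B. (x \<bullet> b) *\<^sub>R b)" for x
  proof -
    have "(x - (\<Sum>b\<in>B. (x \<bullet> b) *\<^sub>R b)) \<bullet> u = 0" if "u \<in> B" for u
    proof -
      have "(\<Sum>b\<in>B. (x \<bullet> b) *\<^sub>R b) \<bullet> u = (\<Sum>b\<in>B. if b = u then x \<bullet> b else 0)"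
        unfolding inner_sum_left using B(2) that by (intro sum.cong) auto
      then show ?thesis
        using B(1) that by (simp add: inner_diff_left)
    qed
    then have "x - (\<Sum>b\<in>B. (x \<bullet> b) *\<^sub>R b) = 0"
      using B(3) by blast
    then show ?thesis
      by (rule eq_iff_diff_eq_0[THEN iffD2])
  qed
  have "f x = x \<bullet> (\<Sum>b\<in>B. f b *\<^sub>R b)" for x
  proof -
    have "f x = f (\<Sum>b\<in>B. (x \<bullet> b) *\<^sub>R b)"
      by (rule arg_cong[OF expansion])
    also have "\<dots> = x \<bullet> (\<Sum>b\<in>B. f b *\<^sub>R b)"
      by (simp add: linear_sum[OF assms] linear_cmul[OF assms] inner_sum_right mult.commute)
    finally show ?thesis .
  qed
  then show ?thesis by blast
qed

lemma smooth_on_UNIV_GDERIV: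
  fixes F :: "'a::finite_dim_inner \<Rightarrow> real"
  assumes "smooth_on UNIV F"
  shows "GDERIV F x :> gradient F x"
proof -
  have "Ck_on 1 UNIV F"
    using assms unfolding smooth_on_def by blast
  then have "F differentiable (at x)"
    by simp
  then obtain F' where F': "(F has_derivative F') (at x)"
    unfolding differentiable_def by blast
  obtain D where "F' = (\<lambda>h. h \<bullet> D)"
    using linear_functional_representation[OF has_derivative_linear[OF F']] by auto
  then have "GDERIV F x :> D"
    using F' by (simp add: gderiv_def)
  then show ?thesis
    using gradient_eqI by metis
qed

text \<open>The chain rule; the last hypothesis says that \<open>E\<close> is the adjoint of \<open>A\<close> applied to \<open>D\<close>.\<close>

lemma GDERIV_compose_linear:
  assumes "bounded_linear A" "GDERIV f (A x) :> D" "\<And>h. A h \<bullet> D = h \<bullet> E"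
  shows "GDERIV (\<lambda>x. f (A x)) x :> E"
  using has_derivative_compose[OF bounded_linear_imp_has_derivative[OF assms(1)]
      assms(2)[unfolded gderiv_def]]
  by (simp add: gderiv_def assms(3))

lemma GDERIV_inner_linear:
  assumes "bounded_linear A" "bounded_linear B" "\<And>h. A x \<bullet> B h + A h \<bullet> B x = h \<bullet> E"
  shows "GDERIV (\<lambda>x. A x \<bullet> B x) x :> E"
  using has_derivative_inner[OF assms(1,2)[THEN bounded_linear_imp_has_derivative], of x]
  by (simp add: gderiv_def assms(3))

text \<open>
  A partial function is the total one composed with an affine embedding, whose derivative has the
  projection to a factor as its adjoint.
\<close>

lemma GDERIV_Pair_fst:
  assumes "GDERIV F (x, y) :> (a, b)"
  shows "GDERIV (\<lambda>x. F (x, y)) x :> a"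
proof -
  have "((\<lambda>x. (x, y)) has_derivative (\<lambda>h. (h, 0))) (at x)"
    by (intro derivative_intros)
  from has_derivative_compose[OF this assms[unfolded gderiv_def]]
  show ?thesis by (simp add: gderiv_def inner_prod_def)
qed

lemma GDERIV_Pair_snd:
  assumes "GDERIV F (x, y) :> (a, b)"
  shows "GDERIV (\<lambda>y. F (x, y)) y :> b"
proof -
  have "((\<lambda>y. (x, y)) has_derivative (\<lambda>h. (0, h))) (at y)"
    by (intro derivative_intros)
  from has_derivative_compose[OF this assms[unfolded gderiv_def]]
  show ?thesis by (simp add: gderiv_def inner_prod_def)
qed


section \<open>Contours and operations on generating functions\<close>

text \<open>
  The partial gradients in the definition of \<^const>\<open>contour\<close> are the components of the total
  gradient, so membership becomes one equation for the latter.
\<close>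

lemma mem_contour_iff:
  fixes F :: "'a::finite_dim_inner \<times> 'w::finite_dim_inner \<Rightarrow> real"
  assumes "smooth_on UNIV F"
  shows "(u, q, p) \<in> contour F \<longleftrightarrow> (\<exists>w. F (q, w) = u \<and> gradient F (q, w) = (p, 0))"
proof -
  have "gradient (\<lambda>q'. F (q', w)) q = fst (gradient F (q, w))"
    and "gradient (\<lambda>w'. F (q, w')) w = snd (gradient F (q, w))" for q w
    using smooth_on_UNIV_GDERIV[OF assms, of "(q, w)"]
    by (auto intro!: gradient_eqI GDERIV_Pair_fst[where b = "snd (gradient F (q, w))"]
        GDERIV_Pair_snd[where a = "fst (gradient F (q, w))"])
  then show ?thesis
    unfolding contour_def by (auto simp: prod_eq_iff)
qed

lemma is_contour_ofI:
  fixes G :: "'a::finite_dim_inner \<times> 'w::finite_dim_inner \<Rightarrow> real"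
  assumes "smooth_on UNIV G" "\<And>x. GDERIV G x :> G' x"
    and "\<And>u q p. (u, q, p) \<in> L \<longleftrightarrow> (\<exists>w. G (q, w) = u \<and> G' (q, w) = (p, 0))"
  shows "is_contour_of L G"
proof -
  have "gradient G x = G' x" for x
    by (rule gradient_eqI[OF assms(2)])
  then have "(u, q, p) \<in> L \<longleftrightarrow> (u, q, p) \<in> contour G" for u q p
    by (simp add: mem_contour_iff[OF assms(1)] assms(3))
  then show ?thesis
    using assms(1) unfolding is_contour_of_def by auto
qed

lemma is_contour_ofD:
  fixes F :: "'a::finite_dim_inner \<times> 'w::finite_dim_inner \<Rightarrow> real"
  assumes "is_contour_of L F"
  shows "smooth_on UNIV F" "GDERIV F x :> gradient F x"
    and "(u, q, p) \<in> L \<longleftrightarrow> (\<exists>w. F (q, w) = u \<and> gradient F (q, w) = (p, 0))"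
  using assms mem_contour_iff smooth_on_UNIV_GDERIV unfolding is_contour_of_def by blast+

text \<open>
  Criticality in \<open>v\<close> forces \<open>q\<close> to be the old covector, while the new covector is the old base
  point \<open>v\<close>; the value \<open>q \<bullet> v - F (v, w)\<close> is then the one prescribed by \<^const>\<open>jet_transform\<close>.
\<close>

lemma is_contour_of_transform:
  fixes F :: "'a::finite_dim_inner \<times> 'w::finite_dim_inner \<Rightarrow> real"
  assumes F: "is_contour_of L F"
  shows "is_contour_of (jet_transform ` L) (\<lambda>(q, v, w). q \<bullet> v - F (v, w))"
proof -
  note bl = bounded_linear_fst bounded_linear_fst_comp[OF bounded_linear_snd] bounded_linear_snd
  let ?G = "\<lambda>x :: 'a \<times> 'a \<times> 'w. fst x \<bullet> fst (snd x) - F (snd x)"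
  let ?G' = "\<lambda>x :: 'a \<times> 'a \<times> 'w.
    (fst (snd x), fst x, 0 :: 'w) - (0, gradient F (snd x))"
  have "is_contour_of (jet_transform ` L) ?G"
  proof (rule is_contour_ofI[where G' = ?G'])
    show "smooth_on UNIV ?G"
      by (intro smooth_on_UNIV_diff smooth_on_UNIV_inner_linear
          smooth_on_UNIV_compose_linear[OF _ is_contour_ofD(1)[OF F]] bl)
    show "GDERIV ?G x :> ?G' x" for x
      by (intro GDERIV_diff GDERIV_inner_linear GDERIV_compose_linear[OF _ is_contour_ofD(2)[OF F]] bl)
        (auto simp: inner_prod_def inner_commute)
    fix u q p
    have "(u, q, p) \<in> jet_transform ` L \<longleftrightarrow> (p \<bullet> q - u, p, q) \<in> L"
      unfolding jet_transform_def by (force simp: inner_commute image_iff)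
    also have "\<dots> \<longleftrightarrow> (\<exists>x. ?G (q, x) = u \<and> ?G' (q, x) = (p, 0))"
    proof -
      have "F (p, w) = p \<bullet> q - u \<and> gradient F (p, w) = (q, 0) \<longleftrightarrow>
          q \<bullet> p - F (p, w) = u \<and> q - fst (gradient F (p, w)) = 0 \<and> snd (gradient F (p, w)) = 0" for w
        by (auto simp: prod_eq_iff inner_commute)
      then show ?thesis
        unfolding is_contour_ofD(3)[OF F] by (simp add: prod_eq_iff)
    qed
    finally show "(u, q, p) \<in> jet_transform ` L \<longleftrightarrow> (\<exists>x. ?G (q, x) = u \<and> ?G' (q, x) = (p, 0))" .
  qed
  then show ?thesis by (simp add: case_prod_unfold)
qed

lemma is_contour_of_slice:
  fixes F :: "('a1::finite_dim_inner \<times> 'a2::finite_dim_inner) \<times> 'w::finite_dim_inner \<Rightarrow> real"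
  assumes F: "is_contour_of L F"
  shows "is_contour_of (jet_slice L) (\<lambda>(q1, w). F ((q1, 0), w))"
proof -
  let ?A = "\<lambda>x :: 'a1 \<times> 'w. ((fst x, 0 :: 'a2), snd x)"
  let ?G' = "\<lambda>x. (fst (fst (gradient F (?A x))), snd (gradient F (?A x)))"
  have A: "bounded_linear ?A"
    by (intro bounded_linear_Pair bounded_linear_fst bounded_linear_snd bounded_linear_zero)
  have "is_contour_of (jet_slice L) (\<lambda>x. F (?A x))"
  proof (rule is_contour_ofI[where G' = ?G'])
    show "smooth_on UNIV (\<lambda>x. F (?A x))"
      by (rule smooth_on_UNIV_compose_linear[OF A is_contour_ofD(1)[OF F]])
    show "GDERIV (\<lambda>x. F (?A x)) x :> ?G' x" for x
      by (rule GDERIV_compose_linear[OF A is_contour_ofD(2)[OF F]]) (simp add: inner_prod_def)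
    show "(u, q, p) \<in> jet_slice L \<longleftrightarrow> (\<exists>w. F (?A (q, w)) = u \<and> ?G' (q, w) = (p, 0))" for u q p
      unfolding jet_slice_def by (auto simp: is_contour_ofD(3)[OF F] prod_eq_iff)
  qed
  then show ?thesis by (simp add: case_prod_unfold)
qed

lemma is_contour_of_jet_contour:
  fixes F :: "('a1::finite_dim_inner \<times> 'a2::finite_dim_inner) \<times> 'w::finite_dim_inner \<Rightarrow> real"
  assumes F: "is_contour_of L F"
  shows "is_contour_of (jet_contour L) (\<lambda>(q1, v, w). F ((q1, v), w))"
proof -
  let ?A = "\<lambda>x :: 'a1 \<times> 'a2 \<times> 'w. ((fst x, fst (snd x)), snd (snd x))"
  let ?G' = "\<lambda>x. (fst (fst (gradient F (?A x))),
    snd (fst (gradient F (?A x))), snd (gradient F (?A x)))"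
  have A: "bounded_linear ?A"
    by (intro bounded_linear_Pair bounded_linear_fst_comp bounded_linear_snd_comp bounded_linear_ident)
  have "is_contour_of (jet_contour L) (\<lambda>x. F (?A x))"
  proof (rule is_contour_ofI[where G' = ?G'])
    show "smooth_on UNIV (\<lambda>x. F (?A x))"
      by (rule smooth_on_UNIV_compose_linear[OF A is_contour_ofD(1)[OF F]])
    show "GDERIV (\<lambda>x. F (?A x)) x :> ?G' x" for x
      by (rule GDERIV_compose_linear[OF A is_contour_ofD(2)[OF F]]) (simp add: inner_prod_def)
    show "(u, q, p) \<in> jet_contour L \<longleftrightarrow> (\<exists>w. F (?A (q, w)) = u \<and> ?G' (q, w) = (p, 0))" for u q p
      unfolding jet_contour_def by (auto simp: is_contour_ofD(3)[OF F] prod_eq_iff)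
  qed
  then show ?thesis by (simp add: case_prod_unfold)
qed

text \<open>
  The remaining three operations add two generating functions after linear substitutions \<open>A1\<close>
  and \<open>A2\<close>; \<open>E1\<close> and \<open>E2\<close> are the adjoints, written out as functions of the two gradients.
\<close>

lemma is_contour_of_sum_compose_linear:
  fixes F1 :: "'a1::finite_dim_inner \<times> 'w1::finite_dim_inner \<Rightarrow> real"
    and F2 :: "'a2::finite_dim_inner \<times> 'w2::finite_dim_inner \<Rightarrow> real"
    and A1 :: "'a::finite_dim_inner \<times> 'w::finite_dim_inner \<Rightarrow> 'a1 \<times> 'w1"
  assumes F1: "is_contour_of L1 F1" and F2: "is_contour_of L2 F2"
    and A1: "bounded_linear A1" and A2: "bounded_linear A2"
    and adj1: "\<And>h D. A1 h \<bullet> D = h \<bullet> E1 D" and adj2: "\<And>h D. A2 h \<bullet> D = h \<bullet> E2 D"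
    and L: "\<And>u q p. (u, q, p) \<in> L \<longleftrightarrow> (\<exists>w. F1 (A1 (q, w)) + F2 (A2 (q, w)) = u \<and>
          E1 (gradient F1 (A1 (q, w))) + E2 (gradient F2 (A2 (q, w))) = (p, 0))"
  shows "is_contour_of L (\<lambda>x. F1 (A1 x) + F2 (A2 x))"
proof (rule is_contour_ofI[where G' = "\<lambda>x. E1 (gradient F1 (A1 x)) + E2 (gradient F2 (A2 x))"])
  show "smooth_on UNIV (\<lambda>x. F1 (A1 x) + F2 (A2 x))"
    by (rule smooth_on_UNIV_add[OF smooth_on_UNIV_compose_linear[OF A1 is_contour_ofD(1)[OF F1]]
          smooth_on_UNIV_compose_linear[OF A2 is_contour_ofD(1)[OF F2]]])
  show "GDERIV (\<lambda>x. F1 (A1 x) + F2 (A2 x)) x :>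
      E1 (gradient F1 (A1 x)) + E2 (gradient F2 (A2 x))" for x
    by (rule GDERIV_add[OF GDERIV_compose_linear[OF A1 is_contour_ofD(2)[OF F1] adj1]
          GDERIV_compose_linear[OF A2 is_contour_ofD(2)[OF F2] adj2]])
qed (rule L)

lemma is_contour_of_prod:
  fixes F1 :: "'a1::finite_dim_inner \<times> 'w1::finite_dim_inner \<Rightarrow> real"
    and F2 :: "'a2::finite_dim_inner \<times> 'w2::finite_dim_inner \<Rightarrow> real"
  assumes F1: "is_contour_of L1 F1" and F2: "is_contour_of L2 F2"
  shows "is_contour_of (jet_prod L1 L2) (\<lambda>((q1, q2), w1, w2). F1 (q1, w1) + F2 (q2, w2))"
proof -
  let ?A1 = "\<lambda>x :: ('a1 \<times> 'a2) \<times> 'w1 \<times> 'w2. (fst (fst x), fst (snd x))"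
  let ?A2 = "\<lambda>x :: ('a1 \<times> 'a2) \<times> 'w1 \<times> 'w2. (snd (fst x), snd (snd x))"
  let ?E1 = "\<lambda>D. ((fst D, 0), snd D, 0)"
  let ?E2 = "\<lambda>D. ((0, fst D), 0, snd D)"
  have "is_contour_of (jet_prod L1 L2) (\<lambda>x. F1 (?A1 x) + F2 (?A2 x))"
  proof (rule is_contour_of_sum_compose_linear[OF F1 F2, where ?E1.0 = ?E1 and ?E2.0 = ?E2])
    show "bounded_linear ?A1" "bounded_linear ?A2"
      by (intro bounded_linear_Pair bounded_linear_fst_comp bounded_linear_snd_comp
          bounded_linear_ident)+
    show "?A1 h \<bullet> D = h \<bullet> ?E1 D" for h D
      by (simp add: inner_prod_def)
    show "?A2 h \<bullet> D = h \<bullet> ?E2 D" for h D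
      by (simp add: inner_prod_def)
    show "(u, q, p) \<in> jet_prod L1 L2 \<longleftrightarrow> (\<exists>w. F1 (?A1 (q, w)) + F2 (?A2 (q, w)) = u \<and>
        ?E1 (gradient F1 (?A1 (q, w))) + ?E2 (gradient F2 (?A2 (q, w))) = (p, 0))" for u q p
      unfolding jet_prod_def
      by (cases q; cases p) (auto simp: is_contour_ofD(3)[OF F1] is_contour_ofD(3)[OF F2] prod_eq_iff)
  qed
  then show ?thesis by (simp add: case_prod_unfold)
qed

lemma is_contour_of_sum:
  fixes F1 :: "'a::finite_dim_inner \<times> 'w1::finite_dim_inner \<Rightarrow> real"
    and F2 :: "'a \<times> 'w2::finite_dim_inner \<Rightarrow> real"
  assumes F1: "is_contour_of L1 F1" and F2: "is_contour_of L2 F2"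
  shows "is_contour_of (jet_sum L1 L2) (\<lambda>(q, w1, w2). F1 (q, w1) + F2 (q, w2))"
proof -
  let ?A1 = "\<lambda>x :: 'a \<times> 'w1 \<times> 'w2. (fst x, fst (snd x))"
  let ?A2 = "\<lambda>x :: 'a \<times> 'w1 \<times> 'w2. (fst x, snd (snd x))"
  let ?E1 = "\<lambda>D. (fst D, snd D, 0)"
  let ?E2 = "\<lambda>D. (fst D, 0, snd D)"
  have "is_contour_of (jet_sum L1 L2) (\<lambda>x. F1 (?A1 x) + F2 (?A2 x))"
  proof (rule is_contour_of_sum_compose_linear[OF F1 F2, where ?E1.0 = ?E1 and ?E2.0 = ?E2])
    show "bounded_linear ?A1" "bounded_linear ?A2"
      by (intro bounded_linear_Pair bounded_linear_fst_comp bounded_linear_snd_comp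
          bounded_linear_ident)+
    show "?A1 h \<bullet> D = h \<bullet> ?E1 D" for h D
      by (simp add: inner_prod_def)
    show "?A2 h \<bullet> D = h \<bullet> ?E2 D" for h D
      by (simp add: inner_prod_def)
    fix u q p
    show "(u, q, p) \<in> jet_sum L1 L2 \<longleftrightarrow> (\<exists>w. F1 (?A1 (q, w)) + F2 (?A2 (q, w)) = u \<and>
        ?E1 (gradient F1 (?A1 (q, w))) + ?E2 (gradient F2 (?A2 (q, w))) = (p, 0))"
      (is "_ \<longleftrightarrow> ?rhs")
    proof
      assume "(u, q, p) \<in> jet_sum L1 L2"
      then obtain p1 p2 w1 w2 where "u = F1 (q, w1) + F2 (q, w2)" "p = p1 + p2"
        "gradient F1 (q, w1) = (p1, 0)" "gradient F2 (q, w2) = (p2, 0)"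
        unfolding jet_sum_def
        by (auto simp: is_contour_ofD(3)[OF F1] is_contour_ofD(3)[OF F2])
      then show ?rhs
        by (intro exI[of _ "(w1, w2)"]) (simp add: zero_prod_def)
    next
      assume ?rhs
      then obtain w1 w2 p1 p2 where "u = F1 (q, w1) + F2 (q, w2)" "p = p1 + p2"
        "gradient F1 (q, w1) = (p1, 0)" "gradient F2 (q, w2) = (p2, 0)"
        by (auto simp: prod_eq_iff)
      moreover from this have "(F1 (q, w1), q, p1) \<in> L1" "(F2 (q, w2), q, p2) \<in> L2"
        unfolding is_contour_ofD(3)[OF F1] is_contour_ofD(3)[OF F2] by blast+
      ultimately show "(u, q, p) \<in> jet_sum L1 L2"
        unfolding jet_sum_def by blast
    qed
  qed
  then show ?thesis by (simp add: case_prod_unfold)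
qed

text \<open>
  Here \<open>\<partial>F1/\<partial>v - \<partial>F2/\<partial>q\<close> is the derivative in \<open>v\<close>: its vanishing makes the covectors equal, and
  \<open>v\<close>, \<open>q - v\<close> are the two base points with sum \<open>q\<close>.
\<close>

lemma is_contour_of_convolution:
  fixes F1 :: "'a::finite_dim_inner \<times> 'w1::finite_dim_inner \<Rightarrow> real"
    and F2 :: "'a \<times> 'w2::finite_dim_inner \<Rightarrow> real"
  assumes F1: "is_contour_of L1 F1" and F2: "is_contour_of L2 F2"
  shows "is_contour_of (jet_convolution L1 L2) (\<lambda>(q, v, w1, w2). F1 (v, w1) + F2 (q - v, w2))"
proof -
  let ?A1 = "\<lambda>x :: 'a \<times> 'a \<times> 'w1 \<times> 'w2. (fst (snd x), fst (snd (snd x)))"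
  let ?A2 = "\<lambda>x :: 'a \<times> 'a \<times> 'w1 \<times> 'w2. (fst x - fst (snd x), snd (snd (snd x)))"
  let ?E1 = "\<lambda>D. (0, fst D, snd D, 0)"
  let ?E2 = "\<lambda>D. (fst D, - fst D, 0, snd D)"
  have "is_contour_of (jet_convolution L1 L2) (\<lambda>x. F1 (?A1 x) + F2 (?A2 x))"
  proof (rule is_contour_of_sum_compose_linear[OF F1 F2, where ?E1.0 = ?E1 and ?E2.0 = ?E2])
    show "bounded_linear ?A1" "bounded_linear ?A2"
      by (intro bounded_linear_Pair bounded_linear_sub bounded_linear_fst_comp
          bounded_linear_snd_comp bounded_linear_ident)+
    show "?A1 h \<bullet> D = h \<bullet> ?E1 D" for h D
      by (simp add: inner_prod_def)
    show "?A2 h \<bullet> D = h \<bullet> ?E2 D" for h D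
      by (simp add: inner_prod_def inner_diff_left)
    fix u q p
    show "(u, q, p) \<in> jet_convolution L1 L2 \<longleftrightarrow>
      (\<exists>w. F1 (?A1 (q, w)) + F2 (?A2 (q, w)) = u \<and>
        ?E1 (gradient F1 (?A1 (q, w))) + ?E2 (gradient F2 (?A2 (q, w))) = (p, 0))"
      (is "_ \<longleftrightarrow> ?rhs")
    proof
      assume "(u, q, p) \<in> jet_convolution L1 L2"
      then obtain q1 q2 w1 w2 where *: "u = F1 (q1, w1) + F2 (q2, w2)" "q = q1 + q2"
        "gradient F1 (q1, w1) = (p, 0)" "gradient F2 (q2, w2) = (p, 0)"
        unfolding jet_convolution_def
        by (auto simp: is_contour_ofD(3)[OF F1] is_contour_ofD(3)[OF F2])
      then show ?rhs
        by (intro exI[of _ "(q1, w1, w2)"]) (simp add: zero_prod_def)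
    next
      assume ?rhs
      then obtain v w1 w2 where "u = F1 (v, w1) + F2 (q - v, w2)"
        "gradient F1 (v, w1) = (p, 0)" "gradient F2 (q - v, w2) = (p, 0)"
        by (auto simp: prod_eq_iff)
      moreover from this have "(F1 (v, w1), v, p) \<in> L1" "(F2 (q - v, w2), q - v, p) \<in> L2"
        unfolding is_contour_ofD(3)[OF F1] is_contour_ofD(3)[OF F2] by blast+
      moreover have "q = v + (q - v)" by simp
      ultimately show "(u, q, p) \<in> jet_convolution L1 L2"
        unfolding jet_convolution_def by blast
    qed
  qed
  then show ?thesis by (simp add: case_prod_unfold)
qed

theorem lemma3p6:
  shows
    "(\<forall>(L :: 'a::finite_dim_inner jet set) (F :: 'a \<times> 'w::finite_dim_inner \<Rightarrow> real).
        legendrian L \<and> is_contour_of L F \<longrightarrow>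
          is_contour_of (jet_transform ` L) (\<lambda>(q, v, w). q \<bullet> v - F (v, w)))
     \<and>
     (\<forall>(L :: ('a1::finite_dim_inner \<times> 'a2::finite_dim_inner) jet set)
       (F :: ('a1 \<times> 'a2) \<times> 'w::finite_dim_inner \<Rightarrow> real).
        legendrian L \<and> is_contour_of L F \<longrightarrow>
          is_contour_of (jet_slice L) (\<lambda>(q1, w). F ((q1, 0), w)) \<and>
          is_contour_of (jet_contour L) (\<lambda>(q1, v, w). F ((q1, v), w)))
     \<and>
     (\<forall>(L1 :: 'a1::finite_dim_inner jet set) (L2 :: 'a2::finite_dim_inner jet set)
       (F1 :: 'a1 \<times> 'w1::finite_dim_inner \<Rightarrow> real) (F2 :: 'a2 \<times> 'w2::finite_dim_inner \<Rightarrow> real).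
        legendrian L1 \<and> legendrian L2 \<and> is_contour_of L1 F1 \<and> is_contour_of L2 F2 \<longrightarrow>
          is_contour_of (jet_prod L1 L2) (\<lambda>((q1, q2), w1, w2). F1 (q1, w1) + F2 (q2, w2)))
     \<and>
     (\<forall>(L1 :: 'a::finite_dim_inner jet set) (L2 :: 'a jet set)
       (F1 :: 'a \<times> 'w1::finite_dim_inner \<Rightarrow> real) (F2 :: 'a \<times> 'w2::finite_dim_inner \<Rightarrow> real).
        legendrian L1 \<and> legendrian L2 \<and> is_contour_of L1 F1 \<and> is_contour_of L2 F2 \<longrightarrow>
          is_contour_of (jet_sum L1 L2) (\<lambda>(q, w1, w2). F1 (q, w1) + F2 (q, w2)) \<and>
          is_contour_of (jet_convolution L1 L2) (\<lambda>(q, v, w1, w2). F1 (v, w1) + F2 (q - v, w2)))"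
  by (intro conjI allI impI; elim conjE)
    (drule is_contour_of_transform, assumption,
     drule is_contour_of_slice, assumption,
     drule is_contour_of_jet_contour, assumption,
     drule (1) is_contour_of_prod, assumption,
     drule (1) is_contour_of_sum, assumption,
     drule (1) is_contour_of_convolution, assumption)

end
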